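(* Given a 3-rotationally symmetric planar convex body $C$, and a partition $Q$ of $C$ into three connected subsets of equal areas, we have that $$d_M(T_b,C)\leq d_M(Q,C),$$ where $T_b$ is the standard trisection of $C$.
   Context: A planar convex body is a compact convex subset of the Euclidean plane with nonempty interior; $d$ is the Euclidean distance. $C$ is 3-rotationally symmetric if there is a center $p\in C$ such that $C$ is invariant under the rotation of angle $120$ degrees about $p$. A partition $Q$ of $C$ into three connected subsets of equal areas is a decomposition $C=C_1\cup C_2\cup C_3$ into compact connected subsets with pairwise disjoint interiors and $\operatorname{area}(C_i)=\frac13\operatorname{area}(C)$ for each $i$ (the pieces are not required to be separated by three curves leaving from a common interior point and ending on $\partial C$). Maximum relative diameter: for such a partition $Q=\{C_1,C_2,C_3\}$, $d_M(Q,C)=\max\{D(C_1),D(C_2),D(C_3)\}$, where $D(C_i)=\max\{d(x,y):x,y\in C_i\}$. Standard trisection: let $T_r(C)$ be the smallest equilateral triangle containing $C$, constructed as follows: choose $m\in\partial C$ with $d(p,m)=d(p,\partial C)$ (any such $m$ if there are several), take the line through $m$ orthogonal to the segment $\overline{pm}$, and its images under the rotations of $120$ and $240$ degrees about $p$; these three lines bound $T_r(C)$. The midpoints $v_1,v_2,v_3$ of the edges of $T_r(C)$ lie on $\partial C$. The standard trisection $T_b=T_b(C)$ is the decomposition of $C$ into three closed subsets (identical up to rotation) by the three line segments joining $p$ to $v_1,v_2,v_3$; it is in particular such a partition. *)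

theory Defs
  imports "HOL-Analysis.Analysis"
begin

text \<open>The Euclidean plane is the type \<^typ>\<open>complex\<close>; the area of a set is its Lebesgue measure.\<close>

definition planar_convex_body :: "complex set \<Rightarrow> bool" where
  "planar_convex_body C \<longleftrightarrow> compact C \<and> convex C \<and> interior C \<noteq> {}"

definition rot120 :: "complex \<Rightarrow> complex \<Rightarrow> complex" where
  "rot120 p z = p + cis (2 * pi / 3) * (z - p)"

definition is_3_center :: "complex set \<Rightarrow> complex \<Rightarrow> bool" where
  "is_3_center C p \<longleftrightarrow> p \<in> C \<and> rot120 p ` C = C"

text \<open>
  Although the pieces form an unordered set, they are automatically distinct if \<open>C\<close> has positive
  area: their areas add up to that of their union \<open>C\<close>.
\<close>
definition connected_equal_area_trisection :: "complex set \<Rightarrow> complex set set \<Rightarrow> bool" where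
  "connected_equal_area_trisection C Q \<longleftrightarrow>
     (\<exists>C1 C2 C3. Q = {C1, C2, C3} \<and> C = C1 \<union> C2 \<union> C3 \<and>
        (\<forall>S\<in>{C1, C2, C3}. compact S \<and> connected S \<and>
            measure lebesgue S = measure lebesgue C / 3) \<and>
        interior C1 \<inter> interior C2 = {} \<and>
        interior C1 \<inter> interior C3 = {} \<and>
        interior C2 \<inter> interior C3 = {})"

text \<open>The partitioned body is the union of the pieces, so it is not an argument here.\<close>
definition max_relative_diameter :: "complex set set \<Rightarrow> real" where
  "max_relative_diameter Q = Max (diameter ` Q)"

definition nearest_boundary_point :: "complex set \<Rightarrow> complex \<Rightarrow> complex \<Rightarrow> bool" where
  "nearest_boundary_point C p m \<longleftrightarrow> m \<in> frontier C \<and> dist p m = infdist p (frontier C)"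

text \<open>
  In the following definitions \<open>p\<close> is the center and \<open>m\<close> the chosen nearest boundary point. The
  triangle \<open>T\<^sub>r\<close> bounded by the three lines is the intersection of the half-planes
  bounded by them that contain \<open>p\<close>.
\<close>
definition side_line :: "complex \<Rightarrow> complex \<Rightarrow> nat \<Rightarrow> complex set" where
  "side_line p m k = (rot120 p ^^ k) ` {z. (z - m) \<bullet> (m - p) = 0}"

definition T_r :: "complex \<Rightarrow> complex \<Rightarrow> complex set" where
  "T_r p m = (\<Inter>k<3. (rot120 p ^^ k) ` {z. (z - m) \<bullet> (m - p) \<le> 0})"

definition edge_midpoints :: "complex \<Rightarrow> complex \<Rightarrow> complex set" where
  "edge_midpoints p m =
     {midpoint a b | a b. \<exists>k<3. T_r p m \<inter> side_line p m k = closed_segment a b}"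

text \<open>
  For a convex body with center \<open>p\<close> the segments end on the boundary, so the components are the
  parts of \<open>C\<close> in the three open sectors at \<open>p\<close>; their closures include the cuts.
\<close>
definition standard_trisection :: "complex set \<Rightarrow> complex \<Rightarrow> complex \<Rightarrow> complex set set" where
  "standard_trisection C p m =
     closure ` components (C - (\<Union>v\<in>edge_midpoints p m. closed_segment p v))"

end

theory Submission
  imports Defs
begin

text \<open>
  Let \<open>r\<close> be the distance from the center \<open>p\<close> to the boundary of \<open>C\<close>, and \<open>R\<close> the largest distance
  from \<open>p\<close> to a point of \<open>C\<close>. The diameter of a piece of the standard trisection is at most
  \<open>max (sqrt 3 * r) R\<close>, and every partition of \<open>C\<close> has a piece of at least that diameter.

  The bound by \<open>R\<close> for partitions is a pigeonhole argument (\<open>cover_diameter_ge_circumradius\<close>): if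
  \<open>x\<close> realizes \<open>R\<close>, then \<open>p\<close>, \<open>x\<close> and the two rotated copies of \<open>x\<close> are four points of \<open>C\<close> at mutual
  distances \<open>R\<close> or \<open>sqrt 3 * R\<close>, and two of them share a piece. The bound by \<open>sqrt 3 * r\<close> is
  topological (\<open>circle_cover_contains_rotated_pair\<close>): the circle of radius \<open>r\<close> about \<open>p\<close> lies in \<open>C\<close>,
  and if no piece contained a point of the circle together with its rotated copy, then the rotated
  copies of one piece would split the connected circle into disjoint closed sets.

  For the standard trisection, \<open>C\<close> lies in the triangle \<open>T\<^sub>r\<close>, because the supporting line of \<open>C\<close> at \<open>m\<close> also
  supports the inscribed disc and is therefore orthogonal to the radius. So a piece lies in a kite
  with corner \<open>p\<close>, right angles at two edge midpoints, and the opposite corner at a vertex of the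
  triangle. Two points of the piece whose directions from \<open>p\<close> differ by at most 60 degrees are at most \<open>R\<close>
  apart. For other pairs, one point is moved parallel to a side of the kite at \<open>p\<close>. The distance is
  convex along this motion, and at its two ends it is either at most \<open>sqrt 3 * r\<close> or the distance of a
  pair of the first kind (\<open>dist_in_kite_le\<close>). It remains to see that the components of the cut
  body are exactly its parts in three open sectors (\<open>components_cut_subset_sectors\<close>).
\<close>

section \<open>Rotation by 120 degrees\<close>

definition omega :: complex ("\<omega>") where
  "\<omega> = cis (2 * pi / 3)"

lemma omega_eq: "\<omega> = Complex (- 1 / 2) (sqrt 3 / 2)"
  by (simp add: omega_def complex_eq_iff cos_120 sin_120)

lemma omega_cube: "\<omega> ^ 3 = 1"
  by (simp add: omega_eq power3_eq_cube complex_eq_iff)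

lemma norm_omega [simp]: "norm \<omega> = 1"
  by (simp add: omega_def)

lemma omega_nonzero [simp]: "\<omega> \<noteq> 0"
  using norm_omega by force

lemma divide_omega_eq: "w / \<omega> = w * \<omega>\<^sup>2"
  using omega_cube by (simp add: field_simps power2_eq_square power3_eq_cube)

lemma divide_omega_square_eq: "w / \<omega>\<^sup>2 = w * \<omega>"
  using omega_cube by (simp add: field_simps power2_eq_square power3_eq_cube)

lemma divide_omega_twice: "w / \<omega> / \<omega> = w * \<omega>"
  using divide_omega_square_eq[of w] by (simp add: power2_eq_square)

lemma Re_Im_times_omega:
  "Re (w * \<omega>) = - (Re w + sqrt 3 * Im w) / 2"
  "Im (w * \<omega>) = (sqrt 3 * Re w - Im w) / 2"
  by (simp_all add: omega_eq field_simps)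

lemma Re_Im_divide_omega:
  "Re (w / \<omega>) = (sqrt 3 * Im w - Re w) / 2"
  "Im (w / \<omega>) = - (sqrt 3 * Re w + Im w) / 2"
  unfolding divide_omega_eq by (simp_all add: omega_eq power2_eq_square algebra_simps)

lemma rot120_eq: "rot120 p z = p + \<omega> * (z - p)"
  by (simp add: rot120_def omega_def)

lemma funpow_rot120: "(rot120 p ^^ k) z = p + \<omega> ^ k * (z - p)"
  by (induction k) (simp_all add: rot120_eq)

lemma rot120_thrice: "rot120 p (rot120 p (rot120 p z)) = z"
  using funpow_rot120[of 3 p z] unfolding omega_cube by (simp add: numeral_3_eq_3)

lemma rot120_center [simp]: "rot120 p p = p"
  by (simp add: rot120_eq)

lemma dist_rot120 [simp]: "dist (rot120 p x) (rot120 p y) = dist x y"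
proof -
  have "rot120 p x - rot120 p y = \<omega> * (x - y)"
    by (simp add: rot120_eq algebra_simps)
  then show ?thesis by (simp add: dist_norm norm_mult)
qed

lemma dist_center_rot120 [simp]: "dist p (rot120 p z) = dist p z"
  using dist_rot120[of p p z] by simp

lemma continuous_on_rot120: "continuous_on S (rot120 p)"
  unfolding rot120_def by (intro continuous_intros)

lemma dist_self_rot120: "dist z (rot120 p z) = sqrt 3 * dist p z"
proof -
  have "norm (1 - \<omega>) = sqrt 3"
    by (simp add: omega_eq cmod_def power2_eq_square)
  moreover have "z - rot120 p z = (1 - \<omega>) * (z - p)"
    by (simp add: rot120_eq algebra_simps)
  ultimately show ?thesis
    by (simp add: dist_norm norm_mult norm_minus_commute)
qed

section \<open>Lower bounds for every covering by three sets\<close>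

text \<open>
  If no set contains a point and its rotated copy, then the three points of each orbit lie in three
  different sets, so exactly one of them is in \<open>A\<close>. Hence \<open>A\<close> and its two rotated copies partition the
  circle into three nonempty closed sets, which contradicts connectedness.
\<close>
lemma circle_cover_contains_rotated_pair:
  assumes cover: "sphere p r \<subseteq> A \<union> B \<union> E" and A: "closed A" and r: "0 \<le> r"
  obtains S z where "S \<in> {A, B, E}" "z \<in> sphere p r" "z \<in> S" "rot120 p z \<in> S"
proof (rule ccontr)
  assume "\<not> thesis"
  with that have no: "\<not> (z \<in> S \<and> rot120 p z \<in> S)"
    if "S \<in> {A, B, E}" "z \<in> sphere p r" for S z
    using that by blast
  define f where "f = rot120 p"
  define K where "K = sphere p r"
  have fff: "f (f (f z)) = z" for z
    by (simp add: f_def rot120_thrice)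
  have fK: "f z \<in> K" if "z \<in> K" for z
    using that by (simp add: f_def K_def)
  have noA: "\<not> (z \<in> A \<and> f z \<in> A)" and noB: "\<not> (z \<in> B \<and> f z \<in> B)"
    and noE: "\<not> (z \<in> E \<and> f z \<in> E)" if "z \<in> K" for z
    using no that by (auto simp: f_def K_def)
  \<comment> \<open>The two rotated copies of \<open>A\<close>, written as preimages.\<close>
  define A1 where "A1 = f -` A \<union> (f \<circ> f) -` A"
  have cont: "continuous_on UNIV f" "continuous_on UNIV (f \<circ> f)"
    unfolding f_def by (intro continuous_on_compose continuous_on_rot120)+
  have "closed A1"
    unfolding A1_def by (intro closed_Un closed_vimage A cont)
  have orbit: "z \<in> A \<or> f z \<in> A \<or> f (f z) \<in> A" if "z \<in> K" for z
    using noB[of z] noB[of "f z"] noB[of "f (f z)"] noE[of z] noE[of "f z"] noE[of "f (f z)"]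
      fK[of z] fK[of "f z"] that fff[of z] cover unfolding K_def[symmetric] by auto
  have "connected K"
    unfolding K_def by (rule connected_sphere) simp
  moreover have "A \<inter> A1 \<inter> K = {}"
  proof -
    have False if "z \<in> A" "z \<in> A1" "z \<in> K" for z
      using that noA[of z] noA[of "f (f z)"] fff[of z] fK by (auto simp: A1_def)
    then show ?thesis by blast
  qed
  moreover have "K \<subseteq> A \<union> A1"
    unfolding A1_def using orbit by fastforce
  ultimately have "A \<inter> K = {} \<or> A1 \<inter> K = {}"
    using connected_closedD[of K A A1] A \<open>closed A1\<close> by blast
  moreover obtain z where "z \<in> K" "z \<in> A"
  proof -
    have "p + of_real r \<in> K"
      using r by (simp add: K_def dist_norm)
    then show thesis using that orbit fK by blast
  qed
  moreover have "f z \<in> A1 \<inter> K" if "z \<in> A" "z \<in> K" for z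
    using that fff fK by (simp add: A1_def)
  ultimately show False by blast
qed

text \<open>
  The four points have mutual distances \<open>dist p x\<close> or \<open>sqrt 3 * dist p x\<close>, and two of them lie in one
  of the three sets.
\<close>
lemma cover_diameter_ge_circumradius:
  assumes cover: "{p, x, rot120 p x, rot120 p (rot120 p x)} \<subseteq> A \<union> B \<union> E"
    and D: "\<And>S y z. S \<in> {A, B, E} \<Longrightarrow> y \<in> S \<Longrightarrow> z \<in> S \<Longrightarrow> dist y z \<le> D"
  shows "dist p x \<le> D"
proof -
  let ?x1 = "rot120 p x" and ?x2 = "rot120 p (rot120 p x)"
  have le: "dist p x \<le> sqrt 3 * dist p x"
    using mult_right_mono[of 1 "sqrt 3" "dist p x"] by simp
  have far: "dist p x \<le> dist x ?x1" "dist p x \<le> dist ?x1 ?x2" "dist p x \<le> dist x ?x2"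
    using le dist_self_rot120[of x p] dist_self_rot120[of ?x1 p] dist_self_rot120[of ?x2 p]
    by (simp_all add: rot120_thrice dist_commute)
  have center: "dist p ?x1 = dist p x" "dist p ?x2 = dist p x"
    by simp_all
  show ?thesis
  proof (rule ccontr)
    assume "\<not> dist p x \<le> D"
    then have apart: "y \<notin> S \<or> z \<notin> S" if "dist p x \<le> dist y z" "S \<in> {A, B, E}" for S y z
      using D[OF that(2), of y z] that(1) by linarith
    have "p \<notin> S \<or> x \<notin> S" "p \<notin> S \<or> ?x1 \<notin> S" "p \<notin> S \<or> ?x2 \<notin> S"
      "x \<notin> S \<or> ?x1 \<notin> S" "?x1 \<notin> S \<or> ?x2 \<notin> S" "x \<notin> S \<or> ?x2 \<notin> S"
      if "S \<in> {A, B, E}" for S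
      using that far center by (intro apart; simp)+
    from this[of A] this[of B] this[of E] cover show False
      by simp argo
  qed
qed

section \<open>The diameter of one sector\<close>

text \<open>
  Write \<open>e = 1 + \<omega>\<close> for the unit vector on the axis of the kite with corners \<open>0\<close>, \<open>1\<close>, \<open>2 * e\<close>, \<open>\<omega>\<close>. The
  two points \<open>a + b * e\<close> and \<open>c * \<omega> + d * e\<close> lie on different sides of the axis, and the conclusion
  bounds their squared distance. By symmetry \<open>d \<le> b\<close>. The squared distance is a convex function of
  \<open>c\<close>, so it suffices to look at the ends of \<open>0 \<le> c \<le> 1\<close>: at \<open>c = 0\<close> the second point is on the
  axis, within angle 60 degrees of the first, and at \<open>c = 1\<close> the value is at most \<open>3\<close>.
\<close>
lemma sector_quadratic_mixed:
  fixes a b c d M :: real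
  assumes nonneg: "0 \<le> a" "0 \<le> b" "0 \<le> c" "0 \<le> d"
    and ab: "a + b / 2 \<le> 1" and cd: "c + d / 2 \<le> 1"
    and M: "3 \<le> M" "a\<^sup>2 + a * b + b\<^sup>2 \<le> M" "c\<^sup>2 + c * d + d\<^sup>2 \<le> M"
  shows "a\<^sup>2 + c\<^sup>2 + (b - d)\<^sup>2 + a * (b - d) - c * (b - d) + a * c \<le> M"
proof -
  have main: "a\<^sup>2 + c\<^sup>2 + f\<^sup>2 + a * f - c * f + a * c \<le> M"
    if f: "0 \<le> f" "f \<le> b" and *: "0 \<le> a" "0 \<le> c" "c \<le> 1" "a + b / 2 \<le> 1"
      "a\<^sup>2 + a * b + b\<^sup>2 \<le> M" for a b c f :: real
  proof -
    define F where "F = (\<lambda>c. a\<^sup>2 + c\<^sup>2 + f\<^sup>2 + a * f - c * f + a * c)"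
    have "f\<^sup>2 \<le> b\<^sup>2" "a * f \<le> a * b"
      using f * by (simp_all add: power_mono mult_left_mono)
    then have F0: "F 0 \<le> M"
      using * by (simp add: F_def)
    have F1: "F 1 \<le> M"
    proof -
      have a: "a \<le> 1 - f / 2" using f * by simp
      \<comment> \<open>\<open>F 1\<close> increases with \<open>a\<close>; at the upper bound for \<open>a\<close> it equals \<open>3 + 3 / 4 * f * (f - 2)\<close>.\<close>
      have "a * (a + f + 1) \<le> (1 - f / 2) * (1 - f / 2 + f + 1)"
        using a f * by (intro mult_mono) auto
      moreover have "f * (f - 2) \<le> 0"
        using f * by (intro mult_nonneg_nonpos) auto
      ultimately have "F 1 \<le> 3"
        by (simp add: F_def power2_eq_square algebra_simps)
      then show ?thesis using M by simp
    qed
    \<comment> \<open>Convexity in explicit form: the quadratic coefficient of \<open>F\<close> is \<open>1\<close>.\<close>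
    have "F c = (1 - c) * F 0 + c * F 1 - c * (1 - c)"
      by (simp add: F_def power2_eq_square algebra_simps)
    also have "\<dots> \<le> (1 - c) * M + c * M - 0"
      using F0 F1 * by (intro diff_mono add_mono mult_left_mono) auto
    finally show ?thesis by (simp add: F_def algebra_simps)
  qed
  show ?thesis
  proof (cases "d \<le> b")
    case True
    show ?thesis using assms True by (intro main[of "b - d" b a c]) auto
  next
    case False
    have "c\<^sup>2 + a\<^sup>2 + (d - b)\<^sup>2 + c * (d - b) - a * (d - b) + c * a \<le> M"
      using assms False by (intro main[of "d - b" d c a]) auto
    then show ?thesis
      by (simp add: power2_eq_square algebra_simps)
  qed
qed

text \<open>
  The points \<open>a + b * e\<close> and \<open>c + d * e\<close> lie on the same side of the axis, so the angle between them is
  at most 60 degrees. Then the opposite side of the triangle that they span with \<open>0\<close> is no longer than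
  the longer of the other two.
\<close>
lemma sector_quadratic_same:
  fixes a b c d M :: real
  assumes nonneg: "0 \<le> a" "0 \<le> b" "0 \<le> c" "0 \<le> d"
    and M: "a\<^sup>2 + a * b + b\<^sup>2 \<le> M" "c\<^sup>2 + c * d + d\<^sup>2 \<le> M"
  shows "(a - c)\<^sup>2 + (a - c) * (b - d) + (b - d)\<^sup>2 \<le> M"
proof -
  have main: "(a - c)\<^sup>2 + (a - c) * (b - d) + (b - d)\<^sup>2 \<le> M"
    if "0 \<le> a" "0 \<le> b" "0 \<le> c" "0 \<le> d" "c \<le> a"
      "a\<^sup>2 + a * b + b\<^sup>2 \<le> M" "c\<^sup>2 + c * d + d\<^sup>2 \<le> M" for a b c d :: real
  proof (cases "d \<le> b")
    case True
    have "(a - c)\<^sup>2 \<le> a\<^sup>2" "(b - d)\<^sup>2 \<le> b\<^sup>2" "(a - c) * (b - d) \<le> a * b"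
      using that True by (auto intro!: power_mono mult_mono)
    then show ?thesis using that by linarith
  next
    case False
    define s t where "s = a - c" and "t = d - b"
    have st: "0 \<le> s" "0 \<le> t" "s \<le> a" "t \<le> d"
      using that False by (simp_all add: s_def t_def)
    have sq: "s\<^sup>2 \<le> a\<^sup>2" "t\<^sup>2 \<le> d\<^sup>2" using st by (auto intro: power_mono)
    have nn: "0 \<le> a * b" "0 \<le> c * d" "0 \<le> b\<^sup>2" "0 \<le> c\<^sup>2" using that by simp_all
    have "s\<^sup>2 - s * t + t\<^sup>2 \<le> M"
    proof (cases "s \<le> t")
      case True
      then have "s * s \<le> s * t" using st by (intro mult_left_mono)
      then have "s\<^sup>2 \<le> s * t" by (simp add: power2_eq_square)
      then show ?thesis using sq that nn by linarith
    next
      case False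
      then have "t * t \<le> s * t" using st by (intro mult_right_mono) auto
      then have "t\<^sup>2 \<le> s * t" by (simp add: power2_eq_square)
      then show ?thesis using sq that nn by linarith
    qed
    then show ?thesis
      by (simp add: s_def t_def power2_eq_square algebra_simps)
  qed
  show ?thesis
  proof (cases "c \<le> a")
    case True
    then show ?thesis using main assms by blast
  next
    case False
    then have "(c - a)\<^sup>2 + (c - a) * (d - b) + (d - b)\<^sup>2 \<le> M"
      using main[of c d a b] assms by simp
    then show ?thesis by (simp add: power2_eq_square algebra_simps)
  qed
qed

text \<open>
  Here the points are \<open>s + t * \<omega>\<close> and \<open>s' + t' * \<omega>\<close>. A point with \<open>t \<le> s\<close> is \<open>(s - t) + t * e\<close>, on the side
  of \<open>1\<close>; one with \<open>s \<le> t\<close> is \<open>(t - s) * \<omega> + s * e\<close>, on the side of \<open>\<omega>\<close>.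
\<close>
lemma kite_quadratic:
  fixes s t s' t' M :: real
  assumes nonneg: "0 \<le> s" "0 \<le> t" "0 \<le> s'" "0 \<le> t'"
    and kite: "s - t / 2 \<le> 1" "t - s / 2 \<le> 1" "s' - t' / 2 \<le> 1" "t' - s' / 2 \<le> 1"
    and M: "3 \<le> M" "s\<^sup>2 - s * t + t\<^sup>2 \<le> M" "s'\<^sup>2 - s' * t' + t'\<^sup>2 \<le> M"
  shows "(s - s')\<^sup>2 - (s - s') * (t - t') + (t - t')\<^sup>2 \<le> M"
proof -
  consider "t \<le> s" "t' \<le> s'" | "s \<le> t" "s' \<le> t'" | "t \<le> s" "s' \<le> t'" | "s \<le> t" "t' \<le> s'"
    by linarith
  then show ?thesis
  proof cases
    case 1
    then show ?thesis
      using sector_quadratic_same[of "s - t" t "s' - t'" t' M] assms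
      by (simp add: power2_eq_square algebra_simps)
  next
    case 2
    then show ?thesis
      using sector_quadratic_same[of "t - s" s "t' - s'" s' M] assms
      by (simp add: power2_eq_square algebra_simps)
  next
    case 3
    then show ?thesis
      using sector_quadratic_mixed[of "s - t" t "t' - s'" s' M] assms
      by (simp add: power2_eq_square algebra_simps)
  next
    case 4
    then show ?thesis
      using sector_quadratic_mixed[of "s' - t'" t' "t - s" s M] assms
      by (simp add: power2_eq_square algebra_simps)
  qed
qed

text \<open>
  The hypotheses put \<open>w\<close> and \<open>w'\<close> in the kite cut off from the sector between \<open>1\<close> and \<open>\<omega>\<close> by the tangents
  of the unit circle at these points. The kite itself has diameter \<open>2\<close>, attained on its axis, so the
  bound on the norms is essential for \<open>M < 2\<close>.
\<close>
lemma dist_in_kite_le: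
  fixes w w' :: complex
  assumes w: "0 < Im w" "Im (w / \<omega>) < 0" "Re w \<le> 1" "Re (w / \<omega>) \<le> 1" "norm w \<le> M"
    and w': "0 < Im w'" "Im (w' / \<omega>) < 0" "Re w' \<le> 1" "Re (w' / \<omega>) \<le> 1" "norm w' \<le> M"
    and M: "sqrt 3 \<le> M"
  shows "norm (w - w') \<le> M"
proof -
  \<comment> \<open>The coordinates in the basis \<open>1\<close>, \<open>\<omega>\<close>: \<open>w = s w + t w * \<omega>\<close>.\<close>
  define s :: "complex \<Rightarrow> real" where "s w = Re w + Im w / sqrt 3" for w
  define t :: "complex \<Rightarrow> real" where "t w = 2 * Im w / sqrt 3" for w
  have r3: "sqrt 3 * sqrt 3 = (3::real)" by simp
  have norm_eq: "(norm w)\<^sup>2 = (s w)\<^sup>2 - s w * t w + (t w)\<^sup>2" for w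
    unfolding cmod_power2 s_def t_def
    by (simp add: power2_eq_square field_simps)
  have diff: "s (w - w') = s w - s w'" "t (w - w') = t w - t w'"
    by (simp_all add: s_def t_def diff_divide_distrib right_diff_distrib)
  have coords: "0 \<le> s w" "0 \<le> t w" "s w - t w / 2 \<le> 1" "t w - s w / 2 \<le> 1"
    if "0 < Im w" "Im (w / \<omega>) < 0" "Re w \<le> 1" "Re (w / \<omega>) \<le> 1" for w
  proof -
    have "s w = (sqrt 3 * Re w + Im w) / sqrt 3"
      by (simp add: s_def field_simps)
    then show "0 \<le> s w"
      using that by (simp add: Re_Im_divide_omega)
    show "0 \<le> t w" "s w - t w / 2 \<le> 1"
      using that by (simp_all add: s_def t_def)
    have "t w - s w / 2 = Re (w / \<omega>)"
      unfolding Re_Im_divide_omega s_def t_def using r3 by (simp add: field_simps)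
    then show "t w - s w / 2 \<le> 1" using that by simp
  qed
  have "0 \<le> M" using M by (rule order_trans[rotated]) simp
  have "(sqrt 3)\<^sup>2 \<le> M\<^sup>2"
    using M by (intro power_mono) auto
  then have sq: "3 \<le> M\<^sup>2" "(norm w)\<^sup>2 \<le> M\<^sup>2" "(norm w')\<^sup>2 \<le> M\<^sup>2"
    using w w' by (simp_all add: power_mono)
  have "(norm (w - w'))\<^sup>2 \<le> M\<^sup>2"
    unfolding norm_eq diff
    by (rule kite_quadratic) (use coords[of w] coords[of w'] w w' sq norm_eq in auto)
  then show ?thesis
    using \<open>0 \<le> M\<close> by (rule power2_le_imp_le)
qed

section \<open>The triangle and its edge midpoints\<close>

text \<open>The coordinate for which \<open>p\<close> is at \<open>0\<close> and \<open>v\<close> at \<open>1\<close>.\<close>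
definition frame_coord :: "complex \<Rightarrow> complex \<Rightarrow> complex \<Rightarrow> complex" where
  "frame_coord p v z = (z - p) / (v - p)"

lemma frame_coord_rot120: "frame_coord p (rot120 p v) z = frame_coord p v z / \<omega>"
  by (simp add: frame_coord_def rot120_eq field_simps)

lemma frame_coord_of_rotated: "frame_coord p v ((rot120 p ^^ k) z) = \<omega> ^ k * frame_coord p v z"
  by (simp add: frame_coord_def funpow_rot120)

lemma from_frame_coord: "v \<noteq> p \<Longrightarrow> p + frame_coord p v z * (v - p) = z"
  by (simp add: frame_coord_def)

lemma inner_frame_coord:
  assumes "v \<noteq> p"
  shows "(z - v) \<bullet> (v - p) = (norm (v - p))\<^sup>2 * (Re (frame_coord p v z) - 1)"
proof -
  let ?w = "frame_coord p v z"
  have "z - v = (?w - 1) * (v - p)"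
    using from_frame_coord[OF assms, of z] by (simp add: algebra_simps)
  then show ?thesis
    by (simp only: cmod_power2) (simp add: inner_complex_def power2_eq_square algebra_simps)
qed

lemma halfplane_iff_frame_coord:
  assumes "v \<noteq> p"
  shows "(z - v) \<bullet> (v - p) \<le> 0 \<longleftrightarrow> Re (frame_coord p v z) \<le> 1"
    and "(z - v) \<bullet> (v - p) = 0 \<longleftrightarrow> Re (frame_coord p v z) = 1"
  using assms by (auto simp: inner_frame_coord mult_le_0_iff)

lemma in_rot120_image_iff:
  "z \<in> (rot120 p ^^ k) ` {y. P (frame_coord p v y)} \<longleftrightarrow> P (frame_coord p v z / \<omega> ^ k)"
proof
  assume "z \<in> (rot120 p ^^ k) ` {y. P (frame_coord p v y)}"
  then show "P (frame_coord p v z / \<omega> ^ k)"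
    by (auto simp: frame_coord_of_rotated)
next
  assume P: "P (frame_coord p v z / \<omega> ^ k)"
  define y where "y = p + (z - p) / \<omega> ^ k"
  have "z = (rot120 p ^^ k) y"
    by (simp add: y_def funpow_rot120)
  moreover from this have "frame_coord p v z / \<omega> ^ k = frame_coord p v y"
    by (simp add: frame_coord_of_rotated)
  ultimately show "z \<in> (rot120 p ^^ k) ` {y. P (frame_coord p v y)}"
    using P by auto
qed

lemma in_T_r_iff:
  assumes "v \<noteq> p"
  shows "z \<in> T_r p v \<longleftrightarrow> Re (frame_coord p v z) \<le> 1 \<and> Re (frame_coord p v z / \<omega>) \<le> 1 \<and>
    Re (frame_coord p v z * \<omega>) \<le> 1"
proof -
  have "z \<in> T_r p v \<longleftrightarrow> (\<forall>k<3. Re (frame_coord p v z / \<omega> ^ k) \<le> 1)"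
    unfolding T_r_def halfplane_iff_frame_coord(1)[OF assms]
    using in_rot120_image_iff[of z _ p "\<lambda>w. Re w \<le> 1" v] by auto
  also have "\<dots> \<longleftrightarrow> (\<forall>k\<in>{0, 1, 2}. Re (frame_coord p v z / \<omega> ^ k) \<le> 1)"
  proof -
    have "{..<3::nat} = {0, 1, 2}" by auto
    then show ?thesis by (metis lessThan_iff)
  qed
  finally show ?thesis
    unfolding divide_omega_square_eq[symmetric] by simp
qed

lemma rot120_neq_center: "v \<noteq> p \<Longrightarrow> rot120 p v \<noteq> p"
  by (simp add: rot120_eq)

text \<open>
  Any of the three edge midpoints generates the same triangle, so it suffices to compute the edge
  through the generating point, as \<open>T_r_edge\<close> does.
\<close>
lemma T_r_rot120:
  assumes "v \<noteq> p"
  shows "T_r p (rot120 p v) = T_r p v"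
proof -
  have "frame_coord p v z / \<omega> * \<omega> = frame_coord p v z" for z
    by simp
  then show ?thesis
    unfolding set_eq_iff in_T_r_iff[OF assms] in_T_r_iff[OF rot120_neq_center[OF assms]]
      frame_coord_rot120 divide_omega_twice
    by metis
qed

lemma in_side_line_iff:
  assumes "v \<noteq> p"
  shows "z \<in> side_line p v k \<longleftrightarrow> Re (frame_coord p ((rot120 p ^^ k) v) z) = 1"
proof -
  have "frame_coord p v z / \<omega> ^ k = frame_coord p ((rot120 p ^^ k) v) z"
    by (simp add: frame_coord_def funpow_rot120 field_simps)
  then show ?thesis
    unfolding side_line_def halfplane_iff_frame_coord(2)[OF assms]
    using in_rot120_image_iff[of z k p "\<lambda>w. Re w = 1" v] by simp
qed

lemma T_r_edge:
  assumes "v \<noteq> p"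
  shows "T_r p v \<inter> {z. Re (frame_coord p v z) = 1} =
    closed_segment (p + Complex 1 (- sqrt 3) * (v - p)) (p + Complex 1 (sqrt 3) * (v - p))"
    (is "?L = closed_segment ?a ?b")
proof -
  have combination: "(1 - u) *\<^sub>R ?a + u *\<^sub>R ?b =
      p + ((1 - u) *\<^sub>R Complex 1 (- sqrt 3) + u *\<^sub>R Complex 1 (sqrt 3)) * (v - p)" for u
    by (simp add: algebra_simps scaleR_conv_of_real)
  show ?thesis
  proof (intro set_eqI iffI)
    fix z assume z: "z \<in> ?L"
    define w where "w = frame_coord p v z"
    have r3: "sqrt 3 * sqrt 3 = (3::real)" by simp
    have Re: "Re w = 1" and "Re (w / \<omega>) \<le> 1" "Re (w * \<omega>) \<le> 1"
      using z unfolding w_def Int_iff in_T_r_iff[OF assms] mem_Collect_eq by blast+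
    then have "sqrt 3 * Im w \<le> sqrt 3 * sqrt 3" "sqrt 3 * (- Im w) \<le> sqrt 3 * sqrt 3"
      unfolding Re_Im_divide_omega Re_Im_times_omega r3 by simp_all
    then have Im: "Im w \<le> sqrt 3" "- Im w \<le> sqrt 3"
      by (simp_all only: mult_le_cancel_left_pos real_sqrt_gt_0_iff zero_less_numeral)
    define u where "u = (Im w / sqrt 3 + 1) / 2"
    have "0 \<le> u" "u \<le> 1" using Im by (simp_all add: u_def field_simps)
    have "w = (1 - u) *\<^sub>R Complex 1 (- sqrt 3) + u *\<^sub>R Complex 1 (sqrt 3)"
      using Re by (simp add: complex_eq_iff u_def field_simps)
    then have "0 \<le> u" "u \<le> 1" "z = (1 - u) *\<^sub>R ?a + u *\<^sub>R ?b"
      using from_frame_coord[OF assms, of z, folded w_def] \<open>0 \<le> u\<close> \<open>u \<le> 1\<close>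
      unfolding combination by simp_all
    then show "z \<in> closed_segment ?a ?b"
      by (auto simp: in_segment)
  next
    fix z assume "z \<in> closed_segment ?a ?b"
    then obtain u where u: "0 \<le> u" "u \<le> 1" and z: "z = (1 - u) *\<^sub>R ?a + u *\<^sub>R ?b"
      by (auto simp: in_segment)
    have "z = p + Complex 1 ((2 * u - 1) * sqrt 3) * (v - p)"
    proof -
      have "Complex 1 ((2 * u - 1) * sqrt 3) = (1 - u) *\<^sub>R Complex 1 (- sqrt 3) + u *\<^sub>R Complex 1 (sqrt 3)"
        by (simp add: complex_eq_iff algebra_simps)
      then show ?thesis
        unfolding z combination by simp
    qed
    then have "frame_coord p v z = Complex 1 ((2 * u - 1) * sqrt 3)"
      using assms by (simp add: frame_coord_def)
    then show "z \<in> ?L"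
      using u unfolding Int_iff mem_Collect_eq in_T_r_iff[OF assms] Re_Im_divide_omega Re_Im_times_omega
      by (simp add: algebra_simps)
  qed
qed

lemma edge_midpoints_eq:
  assumes "m \<noteq> p"
  shows "edge_midpoints p m = {m, rot120 p m, rot120 p (rot120 p m)}"
proof -
  define v where "v k = (rot120 p ^^ k) m" for k
  have v: "v k \<noteq> p" for k
    using assms by (simp add: v_def funpow_rot120)
  have T: "T_r p (v k) = T_r p m" for k
    by (induction k) (use v in \<open>simp_all add: v_def T_r_rot120\<close>)
  have edge: "T_r p m \<inter> side_line p m k =
      closed_segment (p + Complex 1 (- sqrt 3) * (v k - p)) (p + Complex 1 (sqrt 3) * (v k - p))" for k
  proof -
    have "side_line p m k = {z. Re (frame_coord p (v k) z) = 1}"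
      by (auto simp: v_def in_side_line_iff[OF assms])
    then show ?thesis
      using T_r_edge[OF v, of k] unfolding T by simp
  qed
  have mid: "midpoint (p + Complex 1 (- sqrt 3) * u) (p + Complex 1 (sqrt 3) * u) = p + u"
    for u by (simp add: midpoint_def complex_eq_iff algebra_simps)
  have "(\<exists>a b. x = midpoint a b \<and> T_r p m \<inter> side_line p m k = closed_segment a b) \<longleftrightarrow> x = v k" for x k
  proof -
    let ?a = "p + Complex 1 (- sqrt 3) * (v k - p)" and ?b = "p + Complex 1 (sqrt 3) * (v k - p)"
    have "midpoint ?a ?b = v k" "midpoint ?b ?a = v k"
      using mid[of "v k - p"] by (simp_all add: midpoint_sym)
    then show ?thesis
      unfolding edge closed_segment_eq doubleton_eq_iff by metis
  qed
  then have "edge_midpoints p m = v ` {..<3}"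
    unfolding edge_midpoints_def by (auto simp: image_iff set_eq_iff) blast+
  also have "{..<3::nat} = {0, 1, 2}" by auto
  finally show ?thesis by (simp add: v_def numeral_2_eq_2)
qed

section \<open>Sectors and components\<close>

text \<open>
  The open sector of 120 degrees at \<open>p\<close> from the ray through \<open>v\<close> counterclockwise to the ray through
  \<open>rot120 p v\<close>. As its angle is below 180 degrees, it is an intersection of two half-planes.
\<close>
definition sector :: "complex \<Rightarrow> complex \<Rightarrow> complex set" where
  "sector p v = {z. 0 < Im (frame_coord p v z) \<and> Im (frame_coord p v z / \<omega>) < 0}"

lemma open_sector: "open (sector p v)"
  unfolding sector_def frame_coord_def divide_inverse
  by (intro open_Collect_conj open_Collect_less continuous_intros)

lemma convex_sector: "convex (sector p v)"
proof -
  have lin: "linear (\<lambda>z. Im (z * c))" for c :: complex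
    by (intro linearI) (simp_all add: algebra_simps)
  define H where "H = (\<lambda>z. Im (z * inverse (v - p))) -` {0<..} \<inter>
      (\<lambda>z. Im (z * (inverse (v - p) * inverse \<omega>))) -` {..<0}"
  have "convex H"
    unfolding H_def by (intro convex_Int convex_linear_vimage lin convex_real_interval)
  moreover have "sector p v = (+) p ` H"
  proof (rule set_eqI)
    fix z
    have "z \<in> (+) p ` H \<longleftrightarrow> z - p \<in> H"
      by (auto simp: image_iff intro!: bexI[of _ "z - p"])
    then show "z \<in> sector p v \<longleftrightarrow> z \<in> (+) p ` H"
      by (simp only: H_def sector_def frame_coord_def divide_inverse mult.assoc) simp
  qed
  ultimately show ?thesis
    by (simp add: convex_translation)
qed

lemma frame_coord_segment:
  assumes "v \<noteq> p"
  shows "z \<in> closed_segment p v \<longleftrightarrow>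
    Im (frame_coord p v z) = 0 \<and> 0 \<le> Re (frame_coord p v z) \<and> Re (frame_coord p v z) \<le> 1"
proof
  assume "z \<in> closed_segment p v"
  then obtain u where u: "0 \<le> u" "u \<le> 1" "z = (1 - u) *\<^sub>R p + u *\<^sub>R v"
    by (auto simp: in_segment)
  then have "z - p = of_real u * (v - p)"
    by (simp add: scaleR_conv_of_real algebra_simps)
  then have "frame_coord p v z = of_real u"
    using assms by (simp add: frame_coord_def)
  with u show "Im (frame_coord p v z) = 0 \<and> 0 \<le> Re (frame_coord p v z) \<and> Re (frame_coord p v z) \<le> 1"
    by simp
next
  let ?w = "frame_coord p v z"
  assume *: "Im ?w = 0 \<and> 0 \<le> Re ?w \<and> Re ?w \<le> 1"
  then have "?w = of_real (Re ?w)" by (simp add: complex_eq_iff)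
  then have "z = (1 - Re ?w) *\<^sub>R p + Re ?w *\<^sub>R v"
    using from_frame_coord[OF assms, of z] by (simp add: scaleR_conv_of_real algebra_simps)
  with * show "z \<in> closed_segment p v"
    by (auto simp: in_segment)
qed

text \<open>
  A component lies in a single piece, as the pieces are open and disjoint, and it contains that piece
  by maximality.
\<close>
lemma components_subset_open_pieces:
  assumes op: "\<And>U. U \<in> \<U> \<Longrightarrow> open U" and dis: "disjoint \<U>" and cover: "X \<subseteq> \<Union>\<U>"
    and conn: "\<And>U. U \<in> \<U> \<Longrightarrow> connected (X \<inter> U)"
  shows "components X \<subseteq> (\<inter>) X ` \<U>"
proof
  fix K assume K: "K \<in> components X"
  then have KX: "K \<subseteq> X" "connected K" "K \<noteq> {}"
    by (auto simp: in_components_subset in_components_connected in_components_nonempty)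
  then obtain z U where z: "z \<in> K" "z \<in> U" "U \<in> \<U>"
    using cover by blast
  have "X \<inter> U \<subseteq> K"
  proof (rule components_maximal[OF K])
    show "connected (X \<inter> U)" "X \<inter> U \<subseteq> X" "K \<inter> (X \<inter> U) \<noteq> {}"
      using conn z KX by auto
  qed
  moreover have "K \<subseteq> U"
  proof -
    have apart: "U \<inter> \<Union>(\<U> - {U}) \<inter> K = {}"
      using dis z by (auto simp: disjoint_def pairwise_def disjnt_def)
    have "open U" "open (\<Union>(\<U> - {U}))"
      using op z by (auto intro!: open_Union)
    moreover have "K \<subseteq> U \<union> \<Union>(\<U> - {U})"
      using KX(1) cover by auto
    ultimately have "U \<inter> K = {} \<or> \<Union>(\<U> - {U}) \<inter> K = {}"
      by (intro connectedD[OF KX(2) _ _ apart])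
    then show ?thesis using z KX cover by blast
  qed
  ultimately show "K \<in> (\<inter>) X ` \<U>"
    using KX z by blast
qed

text \<open>
  Within \<open>C\<close>, the cuts agree with the three rays that bound the sectors: a point of \<open>C\<close> on such a ray
  has coordinate at most \<open>1\<close> because \<open>C\<close> lies in the triangle. The first claim makes the components
  finite in number; the second serves to show that there is one.
\<close>
lemma components_cut_subset_sectors:
  assumes C: "convex C" "C \<subseteq> T_r p m" and m: "m \<noteq> p"
  defines "m1 \<equiv> rot120 p m" and "m2 \<equiv> rot120 p (rot120 p m)"
  defines "X \<equiv> C - (\<Union>v\<in>{m, m1, m2}. closed_segment p v)"
  shows "components X \<subseteq> (\<lambda>v. C \<inter> sector p v) ` {m, m1, m2}"
    and "C \<inter> sector p m1 \<subseteq> X"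
proof -
  define w where "w z = frame_coord p m z" for z
  have ne: "m1 \<noteq> p" "m2 \<noteq> p"
    using m by (simp_all add: m1_def m2_def rot120_neq_center)
  note reim = Re_Im_divide_omega Re_Im_times_omega
  have coord: "frame_coord p m z = w z" "frame_coord p m1 z = w z / \<omega>"
    "frame_coord p m2 z = w z * \<omega>" for z
    unfolding w_def m1_def m2_def frame_coord_rot120 divide_omega_twice by (rule refl)+
  have cancel: "w z * \<omega> / \<omega> = w z" for z
    by simp
  have sect: "z \<in> sector p m \<longleftrightarrow> 0 < Im (w z) \<and> 0 < sqrt 3 * Re (w z) + Im (w z)"
    "z \<in> sector p m1 \<longleftrightarrow> sqrt 3 * Re (w z) + Im (w z) < 0 \<and> sqrt 3 * Re (w z) < Im (w z)"
    "z \<in> sector p m2 \<longleftrightarrow> Im (w z) < sqrt 3 * Re (w z) \<and> Im (w z) < 0" for z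
    unfolding sector_def mem_Collect_eq coord divide_omega_twice cancel reim by auto
  have scale: "0 \<le> x \<longleftrightarrow> 0 \<le> sqrt 3 * x" for x :: real
    by (simp add: zero_le_mult_iff)
  have r3: "sqrt 3 * (sqrt 3 * x) = 3 * x" for x :: real
    by (simp flip: mult.assoc)
  have ray: "z \<in> closed_segment p m \<longleftrightarrow> Im (w z) = 0 \<and> 0 \<le> sqrt 3 * Re (w z)"
    "z \<in> closed_segment p m1 \<longleftrightarrow> sqrt 3 * Re (w z) = - Im (w z) \<and> 0 \<le> Im (w z)"
    "z \<in> closed_segment p m2 \<longleftrightarrow> sqrt 3 * Re (w z) = Im (w z) \<and> Im (w z) \<le> 0"
    if "z \<in> C" for z
  proof -
    have T: "Re (w z) \<le> 1" "Re (w z / \<omega>) \<le> 1" "Re (w z * \<omega>) \<le> 1"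
      using that C(2) in_T_r_iff[OF m, of z] unfolding w_def by blast+
    show "z \<in> closed_segment p m \<longleftrightarrow> Im (w z) = 0 \<and> 0 \<le> sqrt 3 * Re (w z)"
      unfolding frame_coord_segment[OF m] coord using T scale by blast
    show "z \<in> closed_segment p m1 \<longleftrightarrow> sqrt 3 * Re (w z) = - Im (w z) \<and> 0 \<le> Im (w z)"
      unfolding frame_coord_segment[OF ne(1)] coord
      using T(2) scale[of "Re (w z / \<omega>)"] unfolding reim by (auto simp: right_diff_distrib r3)
    have "sqrt 3 * Re (w z * \<omega>) = - (sqrt 3 * Re (w z) + 3 * Im (w z)) / 2"
      using r3[of "Im (w z)"] unfolding reim
      by (simp add: distrib_left right_diff_distrib diff_divide_distrib)
    then show "z \<in> closed_segment p m2 \<longleftrightarrow> sqrt 3 * Re (w z) = Im (w z) \<and> Im (w z) \<le> 0"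
      unfolding frame_coord_segment[OF ne(2)] coord scale[of "Re (w z * \<omega>)"]
      using T(3) unfolding reim by auto
  qed
  have in_X: "z \<in> X \<longleftrightarrow> z \<in> C \<and> z \<notin> closed_segment p m \<and> z \<notin> closed_segment p m1 \<and>
      z \<notin> closed_segment p m2" for z
    by (auto simp: X_def)
  have X_sector: "X \<inter> sector p v = C \<inter> sector p v" if "v \<in> {m, m1, m2}" for v
    using that by (auto simp: in_X ray sect)
  then show "C \<inter> sector p m1 \<subseteq> X" by blast
  have "disjoint (sector p ` {m, m1, m2})"
    by (auto simp: disjoint_def pairwise_def disjnt_def sect disjoint_iff)
  moreover have "X \<subseteq> \<Union>(sector p ` {m, m1, m2})"
  proof
    fix z assume "z \<in> X"
    then show "z \<in> \<Union>(sector p ` {m, m1, m2})"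
      unfolding in_X by (auto simp: ray sect)
  qed
  moreover have "connected (X \<inter> U)" if "U \<in> sector p ` {m, m1, m2}" for U
    using that X_sector convex_Int[OF C(1) convex_sector] convex_connected by fastforce
  ultimately have "components X \<subseteq> (\<inter>) X ` sector p ` {m, m1, m2}"
    by (intro components_subset_open_pieces) (auto simp: open_sector)
  also have "\<dots> = (\<lambda>v. X \<inter> sector p v) ` {m, m1, m2}"
    by (simp only: image_image)
  also have "\<dots> = (\<lambda>v. C \<inter> sector p v) ` {m, m1, m2}"
    using X_sector by (rule image_cong[OF refl])
  finally show "components X \<subseteq> (\<lambda>v. C \<inter> sector p v) ` {m, m1, m2}" .
qed

section \<open>Convex bodies with a center of order three\<close>

text \<open>
  If \<open>a\<close> is an inner normal of a supporting hyperplane at \<open>m\<close>, then the point of the ball farthest in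
  direction \<open>- a\<close> lies on the inner side. This forces equality in the Cauchy-Schwarz inequality for
  \<open>- a\<close> and \<open>m - p\<close>, so the two are parallel.
\<close>
lemma tangent_halfplane:
  fixes m p z :: "'a :: euclidean_space"
  assumes S: "convex S" "m \<in> frontier S" "cball p (dist p m) \<subseteq> S" and m: "m \<noteq> p" and z: "z \<in> S"
  shows "(z - m) \<bullet> (m - p) \<le> 0"
proof -
  have "ball p (dist p m) \<subseteq> interior S"
    using S(3) by (intro interior_maximal) auto
  then have "interior S \<noteq> {}"
    using m by auto
  then have "m \<in> closure S" "m \<notin> rel_interior S"
    using S(2) by (auto simp: frontier_def rel_interior_nonempty_interior)
  then obtain a where a: "a \<noteq> 0" "\<And>y. y \<in> closure S \<Longrightarrow> a \<bullet> m \<le> a \<bullet> y"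
    using supporting_hyperplane_relative_frontier[OF S(1)] by metis
  then have a_le: "a \<bullet> m \<le> a \<bullet> y" if "y \<in> S" for y
    using that closure_subset by blast
  have "p - (dist p m / norm a) *\<^sub>R a \<in> S"
    using S(3) a(1) by (intro subsetD[OF S(3)]) (simp add: dist_norm)
  from a_le[OF this] have "a \<bullet> m \<le> a \<bullet> p - dist p m * norm a"
    using a(1) by (simp add: inner_diff_right power2_norm_eq_inner[symmetric] power2_eq_square)
  then have "norm (- a) * norm (m - p) \<le> (- a) \<bullet> (m - p)"
    by (simp add: inner_diff_right dist_norm norm_minus_commute algebra_simps)
  with norm_cauchy_schwarz[of "- a" "m - p"]
  have "norm (- a) *\<^sub>R (m - p) = norm (m - p) *\<^sub>R (- a)"
    by (subst norm_cauchy_schwarz_eq[symmetric]) simp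
  then have "norm (- a) * ((z - m) \<bullet> (m - p)) = norm (m - p) * ((z - m) \<bullet> (- a))"
    by (metis inner_scaleR_right)
  moreover have "(z - m) \<bullet> (- a) \<le> 0"
    using a_le[OF z] by (simp add: inner_diff_left inner_diff_right inner_commute)
  ultimately have "norm a * ((z - m) \<bullet> (m - p)) \<le> 0"
    by (simp add: mult_nonneg_nonpos)
  then show ?thesis
    using a(1) by (simp add: mult_le_0_iff)
qed

text \<open>
  The center is the centroid of the orbit of any interior point \<open>x\<close>, so it is two thirds of the way from
  \<open>x\<close> to the midpoint of the two rotated copies of \<open>x\<close>.
\<close>
lemma center_in_interior:
  assumes "convex C" "interior C \<noteq> {}" "rot120 p ` C = C"
  shows "p \<in> interior C"
proof -
  obtain x where x: "x \<in> interior C" using assms by blast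
  then have C: "rot120 p x \<in> C" "rot120 p (rot120 p x) \<in> C"
    using assms(3) interior_subset by blast+
  define y where "y = midpoint (rot120 p x) (rot120 p (rot120 p x))"
  have "y \<in> C"
    using closed_segment_subset[OF C assms(1)] midpoint_in_closed_segment unfolding y_def by blast
  then have "y - (1 / 3) *\<^sub>R (y - x) \<in> interior C"
    using assms(1) x closure_subset by (intro mem_interior_closure_convex_shrink) auto
  also have "y - (1 / 3) *\<^sub>R (y - x) = p"
    by (simp add: y_def midpoint_def rot120_eq omega_eq complex_eq_iff field_simps)
  finally show ?thesis .
qed

text \<open>
  The open ball is connected and misses the boundary, so it cannot leave \<open>C\<close>; nor can its closure.
\<close>
lemma inball_subset:
  fixes C :: "'a :: euclidean_space set"
  assumes "closed C" "p \<in> interior C" "m \<in> frontier C" "dist p m = infdist p (frontier C)"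
  shows "cball p (dist p m) \<subseteq> C" and "m \<noteq> p"
proof -
  show "m \<noteq> p" using assms(2,3) by (auto simp: frontier_def)
  have "ball p (dist p m) \<inter> frontier C = {}"
    using infdist_le[of _ "frontier C" p] unfolding assms(4) by force
  moreover have "p \<in> ball p (dist p m) \<inter> C"
    using \<open>m \<noteq> p\<close> assms(2) interior_subset by auto
  ultimately have "ball p (dist p m) \<subseteq> C"
    using connected_Int_frontier[of "ball p (dist p m)" C] by blast
  then have "closure (ball p (dist p m)) \<subseteq> C"
    using assms(1) by (rule closure_minimal)
  then show "cball p (dist p m) \<subseteq> C"
    using \<open>m \<noteq> p\<close> by simp
qed

lemma subset_T_r:
  assumes C: "convex C" "rot120 p ` C = C" "m \<in> frontier C" "cball p (dist p m) \<subseteq> C" "m \<noteq> p"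
  shows "C \<subseteq> T_r p m"
proof -
  have rot_pow: "(rot120 p ^^ k) ` C = C" for k
  proof (induction k)
    case (Suc k)
    have "(rot120 p ^^ Suc k) ` C = rot120 p ` (rot120 p ^^ k) ` C"
      by (simp add: image_image)
    then show ?case unfolding Suc C(2) .
  qed simp
  have "C \<subseteq> {z. (z - m) \<bullet> (m - p) \<le> 0}"
    using tangent_halfplane[OF C(1,3,4,5)] by (intro subsetI CollectI)
  then have "(rot120 p ^^ k) ` C \<subseteq> (rot120 p ^^ k) ` {z. (z - m) \<bullet> (m - p) \<le> 0}" for k
    by (rule image_mono)
  then show ?thesis
    unfolding T_r_def rot_pow by (rule INT_greatest)
qed

lemma dist_in_sector_le:
  assumes C: "C \<subseteq> T_r p v" and v: "v \<noteq> p"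
    and D: "sqrt 3 * dist p v \<le> D" "\<And>z. z \<in> C \<Longrightarrow> dist p z \<le> D"
    and x: "x \<in> C \<inter> sector p v" and y: "y \<in> C \<inter> sector p v"
  shows "dist x y \<le> D"
proof -
  define w where "w z = frame_coord p v z" for z
  have pos: "0 < dist p v" using v by simp
  have w: "0 < Im (w z)" "Im (w z / \<omega>) < 0" "Re (w z) \<le> 1" "Re (w z / \<omega>) \<le> 1"
      "norm (w z) \<le> D / dist p v"
    if "z \<in> C \<inter> sector p v" for z
  proof -
    show "0 < Im (w z)" "Im (w z / \<omega>) < 0"
      using that by (simp_all add: sector_def w_def)
    have "z \<in> T_r p v" using that C by blast
    then show "Re (w z) \<le> 1" "Re (w z / \<omega>) \<le> 1"
      by (simp_all add: in_T_r_iff[OF v] w_def)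
    have "norm (w z) = dist p z / dist p v"
      by (simp add: w_def frame_coord_def norm_divide dist_norm norm_minus_commute)
    then show "norm (w z) \<le> D / dist p v"
      using D(2)[of z] that pos by (simp add: divide_right_mono)
  qed
  have "sqrt 3 \<le> D / dist p v"
    using D(1) pos by (simp add: pos_le_divide_eq)
  then have "norm (w x - w y) \<le> D / dist p v"
    using w[OF x] w[OF y] by (intro dist_in_kite_le)
  moreover have "norm (w x - w y) = dist x y / dist p v"
    by (simp add: w_def frame_coord_def norm_divide dist_norm norm_minus_commute
        flip: diff_divide_distrib)
  ultimately show ?thesis
    using pos by (simp add: divide_le_cancel)
qed

theorem proposition5p1:
  fixes C :: "complex set" and p m :: complex and Q :: "complex set set"
  assumes "planar_convex_body C"
    and "is_3_center C p"
    and "nearest_boundary_point C p m"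
    and "connected_equal_area_trisection C Q"
  shows "max_relative_diameter (standard_trisection C p m) \<le> max_relative_diameter Q"
proof -
  define D where "D = max_relative_diameter Q"
  define m1 m2 where "m1 = rot120 p m" and "m2 = rot120 p (rot120 p m)"
  have C: "compact C" "convex C" "interior C \<noteq> {}" "rot120 p ` C = C" "p \<in> C"
    using assms(1,2) by (auto simp: planar_convex_body_def is_3_center_def)
  have m: "m \<in> frontier C" "dist p m = infdist p (frontier C)"
    using assms(3) by (auto simp: nearest_boundary_point_def)
  have p: "p \<in> interior C"
    using C(2,3,4) by (rule center_in_interior)
  have inball: "cball p (dist p m) \<subseteq> C" "m \<noteq> p"
    using inball_subset[OF compact_imp_closed[OF C(1)] p m] by auto
  have rot: "rot120 p z \<in> C" if "z \<in> C" for z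
    using that C(4) by blast
  have C_sub: "C \<subseteq> T_r p m"
    using C(2,4) m(1) inball by (rule subset_T_r)

  obtain C1 C2 C3 where Q: "Q = {C1, C2, C3}" "C = C1 \<union> C2 \<union> C3"
    and pieces: "\<forall>S\<in>{C1, C2, C3}. compact S \<and> connected S \<and>
      measure lebesgue S = measure lebesgue C / 3"
    using assms(4) unfolding connected_equal_area_trisection_def by (elim exE conjE) (rule that)
  have compact: "compact S" if "S \<in> {C1, C2, C3}" for S
    using pieces that by blast
  have D: "dist y z \<le> D" if "S \<in> {C1, C2, C3}" "y \<in> S" "z \<in> S" for S y z
  proof -
    have "dist y z \<le> diameter S"
      using that compact by (intro diameter_bounded_bound compact_imp_bounded)
    also have "\<dots> \<le> D"
      unfolding D_def max_relative_diameter_def Q(1) using that(1) by (intro Max_ge) auto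
    finally show ?thesis .
  qed
  have D_circumradius: "dist p x \<le> D" if "x \<in> C" for x
    by (rule cover_diameter_ge_circumradius[of p x C1 C2 C3, OF _ D])
      (use that C(5) rot Q(2) in auto)
  have D_inradius: "sqrt 3 * dist p m \<le> D"
  proof -
    have "sphere p (dist p m) \<subseteq> C1 \<union> C2 \<union> C3"
      using inball(1) sphere_cball unfolding Q(2)[symmetric] by (rule subset_trans[rotated])
    moreover have "closed C1"
      using compact by (simp add: compact_imp_closed)
    ultimately obtain S z where "S \<in> {C1, C2, C3}" "z \<in> sphere p (dist p m)" "z \<in> S" "rot120 p z \<in> S"
      using zero_le_dist by (rule circle_cover_contains_rotated_pair)
    then show ?thesis
      using D[of S z "rot120 p z"] by (simp add: dist_self_rot120)
  qed

  have rotated: "m1 \<noteq> p" "m2 \<noteq> p" "T_r p m1 = T_r p m" "T_r p m2 = T_r p m"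
      "dist p m1 = dist p m" "dist p m2 = dist p m"
    using inball(2) by (simp_all add: m1_def m2_def rot120_neq_center T_r_rot120)
  have piece: "diameter (closure (C \<inter> sector p v)) \<le> D" if "v \<in> {m, m1, m2}" for v
  proof -
    have v: "v \<noteq> p" and T: "T_r p v = T_r p m" and dist_v: "dist p v = dist p m"
      using that rotated inball(2) by auto
    have "0 \<le> D" using D_circumradius[OF C(5)] by simp
    have "dist x y \<le> D" if "x \<in> C \<inter> sector p v" "y \<in> C \<inter> sector p v" for x y
    proof (rule dist_in_sector_le[OF _ v _ D_circumradius that])
      show "C \<subseteq> T_r p v" "sqrt 3 * dist p v \<le> D"
        using C_sub D_inradius by (simp_all add: T dist_v)
    qed
    then have "diameter (C \<inter> sector p v) \<le> D"
      using \<open>0 \<le> D\<close> by (intro diameter_le) (auto simp: dist_norm)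
    moreover have "bounded (C \<inter> sector p v)"
      using C(1) by (simp add: bounded_Int compact_imp_bounded)
    ultimately show ?thesis
      by (simp add: diameter_closure)
  qed

  define X where "X = C - (\<Union>v\<in>{m, m1, m2}. closed_segment p v)"
  have X: "components X \<subseteq> (\<lambda>v. C \<inter> sector p v) ` {m, m1, m2}" "C \<inter> sector p m1 \<subseteq> X"
    unfolding X_def m1_def m2_def using components_cut_subset_sectors[OF C(2) C_sub inball(2)] by auto
  have std: "standard_trisection C p m = closure ` components X"
    unfolding standard_trisection_def edge_midpoints_eq[OF inball(2)] X_def m1_def m2_def ..
  have "X \<noteq> {}"
  proof -
    \<comment> \<open>The ray from \<open>p\<close> opposite to \<open>m\<close> bisects the sector between the two rotated copies of \<open>m\<close>.\<close>
    define z where "z = p - (m - p) / 2"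
    have coord: "frame_coord p m1 z = - (1 / 2) / \<omega>"
      using inball(2) by (simp add: m1_def z_def frame_coord_rot120) (simp add: frame_coord_def field_simps)
    have "z \<in> cball p (dist p m)"
      by (simp add: z_def dist_norm norm_divide norm_minus_commute)
    moreover have "z \<in> sector p m1"
      unfolding sector_def mem_Collect_eq coord divide_omega_twice Re_Im_divide_omega Re_Im_times_omega
      by simp
    ultimately show ?thesis using inball(1) X(2) by blast
  qed
  then have "components X \<noteq> {}" by simp
  moreover have "finite (components X)"
    using X(1) by (rule finite_subset) simp
  ultimately have "max_relative_diameter (closure ` components X) \<le> D"
    unfolding max_relative_diameter_def
  proof (intro Max.boundedI)
    fix d assume "d \<in> diameter ` closure ` components X"
    then obtain K where "K \<in> components X" "d = diameter (closure K)" by blast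
    then show "d \<le> D" using X(1) piece by blast
  qed simp_all
  then show ?thesis
    unfolding std D_def .
qed

end
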